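(* Let $\lambda_0\in(0,\infty]$, let $\phi_1,\phi_2\in\Phi$ with $\phi_1(\lambda)\le\phi_2(\lambda)$, and let $\xi$ be a real-valued random variable such that $$\exp(\phi_1(\lambda))\le\mathbf E\exp(\lambda\xi)\le\exp(\phi_2(\lambda)),\qquad|\lambda|<\lambda_0.$$ Put $S(\lambda,x)=\lambda x-\phi_2^*(x)$, $S'_x=\partial S/\partial x$, and $x_0(\lambda)=\mathrm{argmax}_{x\in\mathbb R}S(\lambda,x)=[(\phi_2^* )']^{-1}(\lambda)$ for $\lambda\in(0,\lambda_0)$. For $\lambda\in(0,\lambda_0)$ and any choice of $x_-=x_-(\lambda)\in(0,x_0(\lambda))$ and $x_+=x_+(\lambda)\in(x_0(\lambda),\infty)$ define, at the point $z=x_-(\lambda)$, $$G_-[x_-,x_+](x_-(\lambda))=e^{-\lambda x_+(\lambda)}\left\{e^{\phi_1(\lambda)}-\lambda\frac{e^{S(\lambda,x_-(\lambda))}}{S'_x(\lambda,x_-(\lambda))}-\lambda\frac{e^{S(\lambda,x_+(\lambda))}}{|S'_x(\lambda,x_+(\lambda))|}\right\},$$ and let $$\overline G_-(z)=\sup G_-[x_-,x_+](z),$$ the supremum being over all such admissible choices with $x_-(\lambda)=z$ (that is, over all $\lambda\in(0,\lambda_0)$ with $z<x_0(\lambda)$ and all $x_+>x_0(\lambda)$). Then $$T_\xi(z)\ge\overline G_-(z),\qquad z\ge1.$$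
   Context: Tail function: $T_\xi(x)=\max(\mathbf P(\xi\ge x),\mathbf P(\xi<-x))$, $x>0$. Young-Fenchel transform: $\phi_2^*(x)=\sup_{|\lambda|<\lambda_0}(\lambda x-\phi_2(\lambda))$. Class $\Phi$: the set of even, strictly convex, twice continuously differentiable functions $\phi$ on $(-\lambda_0,\lambda_0)$, positive for $\lambda\ne0$, with $\phi(0)=\phi'(0)=0$, $\phi''(0)>0$ and $\phi(\lambda)/\lambda\to\infty$ as $\lambda\to\lambda_0$. Convention: the supremum over an empty set is $-\infty$. *)

theory Defs
  imports "HOL-Probability.Probability"
begin

definition sym_interval :: "ereal \<Rightarrow> real set" where
  "sym_interval \<Lambda> = {t. ereal \<bar>t\<bar> < \<Lambda>}"

definition strictly_convex_on :: "real set \<Rightarrow> (real \<Rightarrow> real) \<Rightarrow> bool" where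
  "strictly_convex_on I f \<longleftrightarrow> convex I \<and>
     (\<forall>x\<in>I. \<forall>y\<in>I. \<forall>u. x \<noteq> y \<and> 0 < u \<and> u < 1 \<longrightarrow>
        f ((1 - u) * x + u * y) < (1 - u) * f x + u * f y)"

text \<open>Members of the class are total functions on the reals, but only their values on
  the open interval of radius \<open>\<Lambda>\<close> are constrained. The limit at the end point is taken
  along \<^term>\<open>at_left \<Lambda>\<close> in the extended reals, so that \<open>\<Lambda> = \<infinity>\<close> is covered.\<close>

definition Phi_class :: "ereal \<Rightarrow> (real \<Rightarrow> real) set" where
  "Phi_class \<Lambda> = {\<phi>.
     (\<forall>t\<in>sym_interval \<Lambda>. \<phi> (- t) = \<phi> t) \<and>
     strictly_convex_on (sym_interval \<Lambda>) \<phi> \<and>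
     \<phi> differentiable_on sym_interval \<Lambda> \<and>
     deriv \<phi> differentiable_on sym_interval \<Lambda> \<and>
     continuous_on (sym_interval \<Lambda>) (deriv (deriv \<phi>)) \<and>
     (\<forall>t\<in>sym_interval \<Lambda>. t \<noteq> 0 \<longrightarrow> 0 < \<phi> t) \<and>
     \<phi> 0 = 0 \<and> deriv \<phi> 0 = 0 \<and> 0 < deriv (deriv \<phi>) 0 \<and>
     filterlim ((\<lambda>t. \<phi> t / t) \<circ> real_of_ereal) at_top (at_left \<Lambda>)}"

text \<open>The supremum is a real one: for \<open>\<phi>\<close> in \<open>Phi_class \<Lambda>\<close> the set is nonempty and
  bounded above, since \<open>\<phi>\<close> is nonnegative and, if \<open>\<Lambda> = \<infinity>\<close>, grows superlinearly.\<close>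

definition young_fenchel :: "ereal \<Rightarrow> (real \<Rightarrow> real) \<Rightarrow> real \<Rightarrow> real" where
  "young_fenchel \<Lambda> \<phi> x = (SUP t\<in>sym_interval \<Lambda>. t * x - \<phi> t)"

definition tail_function :: "'a measure \<Rightarrow> ('a \<Rightarrow> real) \<Rightarrow> real \<Rightarrow> real" where
  "tail_function M \<xi> x =
     max (measure M {\<omega>\<in>space M. \<xi> \<omega> \<ge> x}) (measure M {\<omega>\<in>space M. \<xi> \<omega> < - x})"

definition S_fun :: "ereal \<Rightarrow> (real \<Rightarrow> real) \<Rightarrow> real \<Rightarrow> real \<Rightarrow> real" where
  "S_fun \<Lambda> \<phi> l x = l * x - young_fenchel \<Lambda> \<phi> x"

definition S_deriv :: "ereal \<Rightarrow> (real \<Rightarrow> real) \<Rightarrow> real \<Rightarrow> real \<Rightarrow> real" where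
  "S_deriv \<Lambda> \<phi> l x = deriv (S_fun \<Lambda> \<phi> l) x"

text \<open>For \<open>\<phi>\<close> in \<open>Phi_class \<Lambda>\<close> and \<open>l\<close> in the interval the maximizer over the whole
  line exists and is unique; it is the solution \<open>x\<close> of
  \<open>deriv (young_fenchel \<Lambda> \<phi>) x = l\<close>.\<close>

definition x_zero :: "ereal \<Rightarrow> (real \<Rightarrow> real) \<Rightarrow> real \<Rightarrow> real" where
  "x_zero \<Lambda> \<phi> l = arg_max_on (S_fun \<Lambda> \<phi> l) UNIV"

definition G_minus ::
  "ereal \<Rightarrow> (real \<Rightarrow> real) \<Rightarrow> (real \<Rightarrow> real) \<Rightarrow> real \<Rightarrow> real \<Rightarrow> real \<Rightarrow> real" where
  "G_minus \<Lambda> \<phi>1 \<phi>2 l xm xp =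
     exp (- l * xp) *
       (exp (\<phi>1 l)
        - l * (exp (S_fun \<Lambda> \<phi>2 l xm) / S_deriv \<Lambda> \<phi>2 l xm)
        - l * (exp (S_fun \<Lambda> \<phi>2 l xp) / \<bar>S_deriv \<Lambda> \<phi>2 l xp\<bar>))"

text \<open>The value of \<open>G_minus\<close> depends on the functions \<open>x\<^sub>-\<close> and \<open>x\<^sub>+\<close> only through their
  values at \<open>l\<close>, so the supremum ranges over \<open>l\<close> and the value of \<open>x\<^sub>+\<close> at \<open>l\<close>, the value
  of \<open>x\<^sub>-\<close> at \<open>l\<close> being \<open>z\<close>. It is taken in the extended reals, where the empty supremum
  is \<open>- \<infinity>\<close>.\<close>

definition G_minus_bar ::
  "ereal \<Rightarrow> (real \<Rightarrow> real) \<Rightarrow> (real \<Rightarrow> real) \<Rightarrow> real \<Rightarrow> ereal" where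
  "G_minus_bar \<Lambda> \<phi>1 \<phi>2 z =
     Sup {ereal (G_minus \<Lambda> \<phi>1 \<phi>2 l z xp) | l xp.
            0 < l \<and> ereal l < \<Lambda> \<and>
            z \<in> {0<..<x_zero \<Lambda> \<phi>2 l} \<and> xp \<in> {x_zero \<Lambda> \<phi>2 l<..}}"

end

theory Submission
  imports Defs
begin

text \<open>
  Write \<open>\<mu>\<close> and \<open>\<nu>\<close> for the slopes of the conjugate \<open>\<phi>2\<^sup>*\<close> at \<open>z\<close> and at \<open>x\<^sub>+\<close>. Because
  \<open>z < x\<^sub>0(l) < x\<^sub>+\<close>, strict convexity of \<open>\<phi>2\<close> gives \<open>0 < \<mu> < l < \<nu>\<close>; the growth of \<open>\<phi>2\<close>
  keeps \<open>\<nu>\<close> inside the interval on which \<open>\<phi>2\<close> controls the exponential moments of \<open>\<xi>\<close>. Conjugacy turns the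
  quantities in \<^const>\<open>G_minus\<close> into elementary ones: \<open>S'(l, z) = l - \<mu>\<close>,
  \<open>S(l, z) = (l - \<mu>) z + \<phi>2(\<mu>)\<close>, and likewise at \<open>x\<^sub>+\<close> with \<open>\<nu>\<close> in place of \<open>\<mu>\<close>.

  The mass of \<open>e\<^bsup>l\<xi>\<^esup>\<close> is then split into three parts. Below \<open>z\<close> it is dominated by a multiple of
  \<open>e\<^bsup>\<mu>\<xi>\<^esup>\<close>, above \<open>x\<^sub>+\<close> its excess over \<open>e\<^bsup>l x\<^sub>+\<^esup>\<close> is dominated by a multiple of \<open>e\<^bsup>\<nu>\<xi>\<^esup>\<close>, and what
  remains is at most \<open>e\<^bsup>l x\<^sub>+\<^esup>\<close> on the event \<open>\<xi> \<ge> z\<close>. This is the pointwise inequality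
  \<open>exp_le_three_regions\<close>. Taking expectations, the bounds for the two outer parts become exactly the
  two terms subtracted in \<^const>\<open>G_minus\<close>, and the rest of the lower moment bound \<open>e\<^bsup>\<phi>1(l)\<^esup>\<close> has to
  be supplied by \<open>e\<^bsup>l x\<^sub>+\<^esup> P(\<xi> \<ge> z)\<close>. Using the exponential moments at the two slopes directly replaces the
  integration by parts against \<open>P(\<xi> \<ge> x) \<le> exp(- \<phi>2\<^sup>*(x))\<close>; it also covers negative \<open>x\<close>, where that tail bound may fail.
\<close>

section \<open>Slopes of functions in the class\<close>

lemma sym_interval_open_convex:
  shows "open (sym_interval \<Lambda>)" and "convex (sym_interval \<Lambda>)"
proof -
  consider "\<Lambda> = \<infinity>" | "\<Lambda> = - \<infinity>" | r where "\<Lambda> = ereal r"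
    by (cases \<Lambda>) simp_all
  then have "open (sym_interval \<Lambda>) \<and> convex (sym_interval \<Lambda>)"
  proof cases
    case 1
    then have "sym_interval \<Lambda> = UNIV"
      by (simp add: sym_interval_def)
    then show ?thesis by simp
  next
    case 2
    then have "sym_interval \<Lambda> = {}"
      by (simp add: sym_interval_def)
    then show ?thesis by simp
  next
    case 3
    then have "sym_interval \<Lambda> = {- r<..<r}"
      by (auto simp: sym_interval_def)
    then show ?thesis by simp
  qed
  then show "open (sym_interval \<Lambda>)" "convex (sym_interval \<Lambda>)"
    by blast+
qed

lemma sym_interval_mono:
  assumes "t \<in> sym_interval \<Lambda>" "\<bar>s\<bar> \<le> \<bar>t\<bar>"
  shows "s \<in> sym_interval \<Lambda>"
proof -
  have "ereal \<bar>s\<bar> \<le> ereal \<bar>t\<bar>"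
    using assms(2) by (simp only: ereal_less_eq)
  also have "\<dots> < \<Lambda>"
    using assms(1) unfolding sym_interval_def by (rule CollectD)
  finally show ?thesis
    unfolding sym_interval_def by (rule CollectI)
qed

lemma Phi_classD:
  assumes "\<phi> \<in> Phi_class \<Lambda>"
  shows "t \<in> sym_interval \<Lambda> \<Longrightarrow> \<phi> (- t) = \<phi> t"
    and "strictly_convex_on (sym_interval \<Lambda>) \<phi>"
    and "\<phi> differentiable_on sym_interval \<Lambda>"
    and "deriv \<phi> differentiable_on sym_interval \<Lambda>"
    and "\<phi> 0 = 0" and "deriv \<phi> 0 = 0"
    and "filterlim ((\<lambda>t. \<phi> t / t) \<circ> real_of_ereal) at_top (at_left \<Lambda>)"
  using assms unfolding Phi_class_def by simp_all

lemma Phi_class_DERIV: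
  assumes "\<phi> \<in> Phi_class \<Lambda>" "t \<in> sym_interval \<Lambda>"
  shows "(\<phi> has_real_derivative deriv \<phi> t) (at t)"
proof -
  have "\<phi> differentiable (at t)"
    using Phi_classD(3)[OF assms(1)] sym_interval_open_convex(1) assms(2)
    by (simp add: differentiable_on_eq_differentiable_at)
  then show ?thesis
    by (simp add: DERIV_deriv_iff_real_differentiable)
qed

lemma Phi_class_isCont_deriv:
  assumes "\<phi> \<in> Phi_class \<Lambda>" "t \<in> sym_interval \<Lambda>"
  shows "isCont (deriv \<phi>) t"
proof -
  have "deriv \<phi> differentiable (at t)"
    using Phi_classD(4)[OF assms(1)] sym_interval_open_convex(1) assms(2)
    by (simp add: differentiable_on_eq_differentiable_at)
  then show ?thesis
    by (rule differentiable_imp_continuous_within)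
qed

text \<open>Convexity puts the graph weakly above the tangent; strict convexity at the midpoint of the
  two arguments makes the inequality strict.\<close>

lemma Phi_class_above_tangent:
  assumes \<phi>: "\<phi> \<in> Phi_class \<Lambda>" and s: "s \<in> sym_interval \<Lambda>" and t: "t \<in> sym_interval \<Lambda>"
    and "s \<noteq> t"
  shows "\<phi> s + deriv \<phi> s * (t - s) < \<phi> t"
proof -
  let ?I = "sym_interval \<Lambda>"
  have strict: "\<phi> ((1 - u) * x + u * y) < (1 - u) * \<phi> x + u * \<phi> y"
    if "x \<in> ?I" "y \<in> ?I" "x \<noteq> y" "0 < u" "u < 1" for x y u
    using Phi_classD(2)[OF \<phi>] that unfolding strictly_convex_on_def by blast
  have conv: "convex_on ?I \<phi>"
  proof (rule convex_onI)
    fix u x y :: real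
    assume "0 < u" "u < 1" "x \<in> ?I" "y \<in> ?I"
    then show "\<phi> ((1 - u) *\<^sub>R x + u *\<^sub>R y) \<le> (1 - u) * \<phi> x + u * \<phi> y"
      using strict[of x y u] by (cases "x = y") (auto simp: algebra_simps)
  qed (rule sym_interval_open_convex)
  define m where "m = (s + t) / 2"
  have m: "m \<in> ?I" "m = (1 - 1/2) * s + 1/2 * t"
    using convexD[OF sym_interval_open_convex(2) s t, of "1/2" "1/2"]
    by (simp_all add: m_def field_simps)
  have "\<phi> m - \<phi> s \<ge> deriv \<phi> s * (m - s)"
    using s m(1) conv sym_interval_open_convex[of \<Lambda>]
    by (intro convex_on_imp_above_tangent[where A = ?I])
       (auto simp: interior_open convex_connected
          intro!: has_field_derivative_at_within Phi_class_DERIV[OF \<phi>])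
  moreover have "\<phi> m < (1 - 1/2) * \<phi> s + 1/2 * \<phi> t"
    unfolding m(2) using strict[OF s t \<open>s \<noteq> t\<close>, of "1/2"] by simp
  moreover have "deriv \<phi> s * (m - s) = deriv \<phi> s * (t - s) / 2"
    by (simp add: m_def field_simps)
  ultimately show ?thesis
    by simp
qed

lemma Phi_class_deriv_strict_mono:
  assumes \<phi>: "\<phi> \<in> Phi_class \<Lambda>" and s: "s \<in> sym_interval \<Lambda>" and t: "t \<in> sym_interval \<Lambda>"
    and "s < t"
  shows "deriv \<phi> s < deriv \<phi> t"
proof -
  have "deriv \<phi> s * (t - s) < deriv \<phi> t * (t - s)"
    using Phi_class_above_tangent[OF \<phi> s t] Phi_class_above_tangent[OF \<phi> t s] \<open>s < t\<close>
    by (simp add: algebra_simps)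
  then show ?thesis
    using \<open>s < t\<close> by simp
qed

text \<open>The slope is unbounded because it dominates the quotient \<open>\<phi>(t) / t\<close>, which tends to
  infinity at the end of the interval.\<close>

lemma Phi_class_deriv_unbounded:
  assumes \<phi>: "\<phi> \<in> Phi_class \<Lambda>" and l: "0 < l" "ereal l < \<Lambda>"
  obtains t where "l < t" "t \<in> sym_interval \<Lambda>" "x < deriv \<phi> t"
proof -
  have "filterlim ((\<lambda>t. \<phi> t / t) \<circ> real_of_ereal) at_top (at_left \<Lambda>)"
    by (rule Phi_classD(7)[OF \<phi>])
  then have "eventually (\<lambda>y. x \<le> \<phi> (real_of_ereal y) / real_of_ereal y) (at_left \<Lambda>)"
    by (simp add: filterlim_at_top comp_def)
  then obtain b where b: "b < \<Lambda>"
    "\<And>y. b < y \<Longrightarrow> y < \<Lambda> \<Longrightarrow> x \<le> \<phi> (real_of_ereal y) / real_of_ereal y"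
    using eventually_at_left[OF l(2)] by auto
  obtain t where t: "max b (ereal l) < ereal t" "ereal t < \<Lambda>"
    using ereal_dense2[of "max b (ereal l)" \<Lambda>] b(1) l by auto
  have t0: "l < t" "t \<in> sym_interval \<Lambda>" "0 \<in> sym_interval \<Lambda>"
    using t l sym_interval_mono[of t \<Lambda> 0] by (auto simp: sym_interval_def)
  have "x \<le> \<phi> t / t"
    using b(2)[of "ereal t"] t by simp
  then have "x * t \<le> \<phi> t"
    using t0 l by (simp add: field_simps)
  also have "\<phi> t < deriv \<phi> t * t"
    using Phi_class_above_tangent[OF \<phi> t0(2,3)] t0 l Phi_classD(5)[OF \<phi>] by simp
  finally show ?thesis
    using that[of t] t0 l by simp
qed

lemma Phi_class_deriv_IVT:
  assumes \<phi>: "\<phi> \<in> Phi_class \<Lambda>" and "a \<in> sym_interval \<Lambda>" "b \<in> sym_interval \<Lambda>" "a < b"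
    and x: "deriv \<phi> a < x" "x < deriv \<phi> b"
  obtains s where "a < s" "s < b" "s \<in> sym_interval \<Lambda>" "deriv \<phi> s = x"
proof -
  have sub: "s \<in> sym_interval \<Lambda>" if "a \<le> s" "s \<le> b" for s
    using that assms(2,3) sym_interval_mono[of a \<Lambda> s] sym_interval_mono[of b \<Lambda> s] by linarith
  obtain s where s: "a \<le> s" "s \<le> b" "deriv \<phi> s = x"
    using IVT[of "deriv \<phi>" a x b] Phi_class_isCont_deriv[OF \<phi> sub] assms by force
  then have "s \<noteq> a" "s \<noteq> b"
    using x by auto
  then show ?thesis
    using s sub by (intro that[of s]) auto
qed

section \<open>Conjugacy\<close>

lemma bdd_above_young_fenchel:
  assumes \<phi>: "\<phi> \<in> Phi_class \<Lambda>" and "0 < \<Lambda>"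
  shows "bdd_above ((\<lambda>t. t * x - \<phi> t) ` sym_interval \<Lambda>)"
proof -
  obtain l where l: "0 < l" "ereal l < \<Lambda>"
    using ereal_dense2[of 0 \<Lambda>] \<open>0 < \<Lambda>\<close> by (auto simp: zero_ereal_def)
  obtain b where b: "l < b" "b \<in> sym_interval \<Lambda>" "\<bar>x\<bar> < deriv \<phi> b"
    using Phi_class_deriv_unbounded[OF \<phi> l] .
  (* Since the slope at b exceeds |x|, passing from t x to phi'(b) |t| only increases the value,
     and the tangent at b bounds phi'(b) u - phi(u) over all u. Evenness allows u = |t|. *)
  have "t * x - \<phi> t \<le> b * deriv \<phi> b - \<phi> b" if t: "t \<in> sym_interval \<Lambda>" for t
  proof -
    have t': "\<bar>t\<bar> \<in> sym_interval \<Lambda>"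
      using t by (simp add: sym_interval_def)
    have "\<phi> \<bar>t\<bar> = \<phi> t"
      using Phi_classD(1)[OF \<phi> t] by (cases "0 \<le> t") simp_all
    moreover have "\<phi> b + deriv \<phi> b * (\<bar>t\<bar> - b) \<le> \<phi> \<bar>t\<bar>"
      using Phi_class_above_tangent[OF \<phi> b(2) t'] by (cases "b = \<bar>t\<bar>") auto
    moreover have "t * x \<le> deriv \<phi> b * \<bar>t\<bar>"
    proof -
      have "t * x \<le> \<bar>x\<bar> * \<bar>t\<bar>"
        by (metis abs_ge_self abs_mult mult.commute)
      also have "\<dots> \<le> deriv \<phi> b * \<bar>t\<bar>"
        using b by (intro mult_right_mono) auto
      finally show ?thesis .
    qed
    ultimately show ?thesis
      by (simp add: algebra_simps)
  qed
  then show ?thesis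
    by (intro bdd_aboveI2)
qed

lemma young_fenchel_ge:
  assumes "\<phi> \<in> Phi_class \<Lambda>" "0 < \<Lambda>" "t \<in> sym_interval \<Lambda>"
  shows "t * x - \<phi> t \<le> young_fenchel \<Lambda> \<phi> x"
  unfolding young_fenchel_def using assms by (intro cSUP_upper bdd_above_young_fenchel)

text \<open>Fenchel's inequality is an equality at a slope of \<open>\<phi>\<close>: this is the tangent inequality
  rearranged.\<close>

lemma young_fenchel_at_slope:
  assumes \<phi>: "\<phi> \<in> Phi_class \<Lambda>" and "0 < \<Lambda>" and s: "s \<in> sym_interval \<Lambda>"
  shows "young_fenchel \<Lambda> \<phi> (deriv \<phi> s) = s * deriv \<phi> s - \<phi> s"
proof (rule antisym)
  show "young_fenchel \<Lambda> \<phi> (deriv \<phi> s) \<le> s * deriv \<phi> s - \<phi> s"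
    unfolding young_fenchel_def
  proof (rule cSUP_least)
    fix t assume t: "t \<in> sym_interval \<Lambda>"
    show "t * deriv \<phi> s - \<phi> t \<le> s * deriv \<phi> s - \<phi> s"
      using Phi_class_above_tangent[OF \<phi> s t] by (cases "s = t") (auto simp: algebra_simps)
  qed (use s in auto)
qed (use young_fenchel_ge assms in auto)

text \<open>Fenchel's inequality at \<open>s\<close> bounds the increments of the conjugate from below by slope \<open>s\<close>.
  From above, the increment from \<open>\<phi>'(s)\<close> to \<open>\<phi>'(r)\<close> has slope between \<open>s\<close> and \<open>r\<close>, and \<open>r\<close> stays
  close to \<open>s\<close> because \<open>\<phi>'\<close> is strictly increasing with the intermediate value property.\<close>

lemma young_fenchel_DERIV:
  assumes \<phi>: "\<phi> \<in> Phi_class \<Lambda>" and \<Lambda>: "0 < \<Lambda>" and s: "s \<in> sym_interval \<Lambda>"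
  shows "(young_fenchel \<Lambda> \<phi> has_real_derivative s) (at (deriv \<phi> s))"
proof -
  let ?f = "young_fenchel \<Lambda> \<phi>" and ?x = "deriv \<phi> s"
  have "((\<lambda>y. (?f y - ?f ?x) / (y - ?x)) \<longlongrightarrow> s) (at ?x)"
  proof (rule tendstoI)
    fix e :: real assume "0 < e"
    obtain d where d: "0 < d" "ball s d \<subseteq> sym_interval \<Lambda>"
      using sym_interval_open_convex(1) s openE by metis
    define h where "h = min e d / 2"
    have h: "0 < h" "h < e" "h < d"
      using d(1) \<open>0 < e\<close> by (auto simp: h_def min_def)
    have I: "s - h \<in> sym_interval \<Lambda>" "s + h \<in> sym_interval \<Lambda>"
      using d(2) h by (auto simp: dist_real_def subset_iff)
    have "?x \<in> {deriv \<phi> (s - h)<..<deriv \<phi> (s + h)}"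
      using Phi_class_deriv_strict_mono[OF \<phi>] s I h by auto
    then have "eventually (\<lambda>y. y \<in> {deriv \<phi> (s - h)<..<deriv \<phi> (s + h)}) (at ?x)"
      by (intro eventually_at_in_open') auto
    moreover have "eventually (\<lambda>y. y \<noteq> ?x) (at ?x)"
      by (simp add: eventually_at_filter)
    ultimately show "eventually (\<lambda>y. dist ((?f y - ?f ?x) / (y - ?x)) s < e) (at ?x)"
    proof eventually_elim
      case (elim y)
      then obtain r where r: "s - h < r" "r < s + h" "r \<in> sym_interval \<Lambda>" "deriv \<phi> r = y"
        using Phi_class_deriv_IVT[OF \<phi> I, of y] h by auto
      have lo: "s * (y - ?x) \<le> ?f y - ?f ?x"
        using young_fenchel_ge[OF \<phi> \<Lambda> s, of y] young_fenchel_at_slope[OF \<phi> \<Lambda> s]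
        by (simp add: algebra_simps)
      have hi: "?f y - ?f ?x \<le> r * (y - ?x)"
        using young_fenchel_ge[OF \<phi> \<Lambda> r(3), of ?x] young_fenchel_at_slope[OF \<phi> \<Lambda> r(3)] r(4)
        by (simp add: algebra_simps)
      have "\<bar>(?f y - ?f ?x) / (y - ?x) - s\<bar> \<le> \<bar>r - s\<bar>"
      proof (cases "?x < y")
        case True
        then have "s \<le> (?f y - ?f ?x) / (y - ?x)" "(?f y - ?f ?x) / (y - ?x) \<le> r"
          using lo hi by (simp_all add: pos_le_divide_eq pos_divide_le_eq)
        then show ?thesis by linarith
      next
        case False
        then have "(?f y - ?f ?x) / (y - ?x) \<le> s" "r \<le> (?f y - ?f ?x) / (y - ?x)"
          using lo hi elim(2) by (simp_all add: neg_le_divide_eq neg_divide_le_eq)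
        then show ?thesis by linarith
      qed
      then show ?case
        using r h by (simp add: dist_real_def)
    qed
  qed
  then show ?thesis
    by (simp add: has_field_derivative_iff)
qed

lemma S_fun_at_slope:
  assumes "\<phi> \<in> Phi_class \<Lambda>" "0 < \<Lambda>" "s \<in> sym_interval \<Lambda>"
  shows "S_fun \<Lambda> \<phi> l (deriv \<phi> s) = (l - s) * deriv \<phi> s + \<phi> s"
  using young_fenchel_at_slope[OF assms] by (simp add: S_fun_def algebra_simps)

lemma S_deriv_at_slope:
  assumes "\<phi> \<in> Phi_class \<Lambda>" "0 < \<Lambda>" "s \<in> sym_interval \<Lambda>"
  shows "S_deriv \<Lambda> \<phi> l (deriv \<phi> s) = l - s"
proof -
  have "(S_fun \<Lambda> \<phi> l has_real_derivative l - s) (at (deriv \<phi> s))"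
    unfolding S_fun_def
    by (auto intro!: derivative_eq_intros young_fenchel_DERIV[OF assms])
  then show ?thesis
    unfolding S_deriv_def by (rule DERIV_imp_deriv)
qed

text \<open>The maximum of \<open>S(l, \<cdot>)\<close> is \<open>\<phi>(l)\<close>. At any maximizer \<open>x\<close> Fenchel's inequality is an equality,
  so that \<open>t \<mapsto> t x - \<phi>(t)\<close> is maximal at the interior point \<open>l\<close>, which forces \<open>x = \<phi>'(l)\<close>.\<close>

lemma x_zero_eq_deriv:
  assumes \<phi>: "\<phi> \<in> Phi_class \<Lambda>" and \<Lambda>: "0 < \<Lambda>" and l: "l \<in> sym_interval \<Lambda>"
  shows "x_zero \<Lambda> \<phi> l = deriv \<phi> l"
proof -
  have le: "S_fun \<Lambda> \<phi> l y \<le> \<phi> l" for y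
    using young_fenchel_ge[OF \<phi> \<Lambda> l, of y] by (simp add: S_fun_def)
  have eq: "S_fun \<Lambda> \<phi> l (deriv \<phi> l) = \<phi> l"
    using S_fun_at_slope[OF \<phi> \<Lambda> l] by simp
  have unique: "x = deriv \<phi> l" if x: "S_fun \<Lambda> \<phi> l x = \<phi> l" for x
  proof -
    have max: "t * x - \<phi> t \<le> l * x - \<phi> l" if "t \<in> sym_interval \<Lambda>" for t
      using young_fenchel_ge[OF \<phi> \<Lambda> that, of x] x by (simp add: S_fun_def)
    obtain d where d: "0 < d" "ball l d \<subseteq> sym_interval \<Lambda>"
      using sym_interval_open_convex(1) l openE by metis
    have "((\<lambda>t. t * x - \<phi> t) has_real_derivative x - deriv \<phi> l) (at l)"
      by (auto intro!: derivative_eq_intros Phi_class_DERIV[OF \<phi> l])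
    then have "x - deriv \<phi> l = 0"
    proof (rule DERIV_local_max[OF _ d(1)])
      show "\<forall>y. \<bar>l - y\<bar> < d \<longrightarrow> y * x - \<phi> y \<le> l * x - \<phi> l"
        using max d(2) by (auto simp: dist_real_def subset_iff)
    qed
    then show ?thesis
      by simp
  qed
  have "is_arg_max (S_fun \<Lambda> \<phi> l) (\<lambda>x. x \<in> UNIV) (deriv \<phi> l)"
    using le eq by (auto simp: is_arg_max_linorder)
  then have "is_arg_max (S_fun \<Lambda> \<phi> l) (\<lambda>x. x \<in> UNIV) (x_zero \<Lambda> \<phi> l)"
    unfolding x_zero_def arg_max_on_def arg_max_def by (rule someI)
  then have "S_fun \<Lambda> \<phi> l (x_zero \<Lambda> \<phi> l) = \<phi> l"
    using le eq by (auto simp: is_arg_max_linorder intro!: antisym) metis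
  then show ?thesis
    by (rule unique)
qed

section \<open>The lower bound for the tail\<close>

text \<open>For \<open>y < z\<close> the tilt \<open>e\<^bsup>(l - m)(y - z)\<^esup> \<le> 1\<close> suffices, the constant \<open>l / (l - m)\<close> being at least
  1. For \<open>y > x\<close> put \<open>w = y - x\<close>: then
  \<open>e\<^bsup>lw\<^esup> - 1 \<le> l w e\<^bsup>lw\<^esup> = l e\<^bsup>nw\<^esup> \<cdot> w e\<^bsup>-(n-l)w\<^esup> \<le> l e\<^bsup>nw\<^esup> / (n - l)\<close>.\<close>

lemma exp_le_three_regions:
  fixes l m n x y z :: real
  assumes "0 \<le> m" "m < l" "l < n"
  shows "exp (l * y) \<le> l / (l - m) * exp ((l - m) * z) * exp (m * y)
           + exp (l * x) * indicator {z..} y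
           + l / (n - l) * exp ((l - n) * x) * exp (n * y)"
    (is "_ \<le> ?A + ?B + ?C")
proof -
  have nonneg: "0 \<le> ?A" "0 \<le> ?B" "0 \<le> ?C"
    using assms by (auto simp: indicator_def)
  consider "y < z" | "z \<le> y" "y \<le> x" | "z \<le> y" "x < y"
    by linarith
  then show ?thesis
  proof cases
    case 1
    have "exp (l * y) = exp ((l - m) * y) * exp (m * y)"
      by (simp add: exp_add[symmetric] algebra_simps)
    also have "\<dots> \<le> exp ((l - m) * z) * exp (m * y)"
      using 1 assms by simp
    also have "\<dots> \<le> l / (l - m) * (exp ((l - m) * z) * exp (m * y))"
      using assms mult_right_mono[of 1 "l / (l - m)" "exp ((l - m) * z) * exp (m * y)"]
      by (simp add: pos_le_divide_eq)
    finally have "exp (l * y) \<le> ?A"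
      by (simp only: mult.assoc)
    then show ?thesis
      using nonneg by linarith
  next
    case 2
    then have "exp (l * y) \<le> ?B"
      using assms by simp
    then show ?thesis
      using nonneg by linarith
  next
    case 3
    define w where "w = y - x"
    have "0 < w"
      using 3 by (simp add: w_def)
    have "1 - l * w \<le> exp (- (l * w))"
      using exp_ge_add_one_self[of "- (l * w)"] by simp
    then have "(1 - l * w) * exp (l * w) \<le> exp (- (l * w)) * exp (l * w)"
      by (intro mult_right_mono) auto
    then have "exp (l * w) - 1 \<le> l * w * exp (l * w)"
      by (simp add: exp_minus algebra_simps)
    also have "\<dots> = l / (n - l) * ((n - l) * w * exp (l * w))"
      using assms by (simp add: field_simps)
    also have "\<dots> \<le> l / (n - l) * (exp ((n - l) * w) * exp (l * w))"
    proof -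
      have "(n - l) * w \<le> exp ((n - l) * w)"
        using exp_ge_add_one_self[of "(n - l) * w"] by linarith
      then show ?thesis
        using assms by (intro mult_left_mono mult_right_mono) auto
    qed
    also have "\<dots> = l / (n - l) * exp (n * w)"
      by (simp add: exp_add[symmetric] algebra_simps)
    finally have "exp (l * x) * (exp (l * w) - 1) \<le> exp (l * x) * (l / (n - l) * exp (n * w))"
      by (rule mult_left_mono) simp
    moreover have "exp (l * x) * exp (l * w) = exp (l * y)"
      by (simp add: w_def exp_add[symmetric] algebra_simps)
    moreover have "exp (l * x) * exp (n * w) = exp ((l - n) * x) * exp (n * y)"
      by (simp add: w_def exp_add[symmetric] algebra_simps)
    ultimately have "exp (l * y) \<le> exp (l * x) + ?C"
      by (simp add: algebra_simps)
    then show ?thesis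
      using nonneg 3 by simp
  qed
qed

text \<open>Whatever part of the moment at \<open>l\<close> the moments at \<open>m < l < n\<close> cannot account for must come from
  the tail; this is the expectation of the pointwise inequality.\<close>

lemma (in prob_space) tail_ge_of_exp_moments:
  fixes \<xi> :: "'a \<Rightarrow> real" and l m n x z a b c :: real
  assumes [measurable]: "\<xi> \<in> borel_measurable M"
    and lmn: "0 \<le> m" "m < l" "l < n"
    and nonneg: "0 \<le> b" "0 \<le> c"
    and a: "ennreal a \<le> (\<integral>\<^sup>+\<omega>. ennreal (exp (l * \<xi> \<omega>)) \<partial>M)"
    and b: "(\<integral>\<^sup>+\<omega>. ennreal (exp (m * \<xi> \<omega>)) \<partial>M) \<le> ennreal b"
    and c: "(\<integral>\<^sup>+\<omega>. ennreal (exp (n * \<xi> \<omega>)) \<partial>M) \<le> ennreal c"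
  shows "a - l / (l - m) * exp ((l - m) * z) * b - l / (n - l) * exp ((l - n) * x) * c
           \<le> exp (l * x) * prob {\<omega>\<in>space M. \<xi> \<omega> \<ge> z}"
proof -
  define A C where "A = l / (l - m) * exp ((l - m) * z)" and "C = l / (n - l) * exp ((l - n) * x)"
  let ?E = "{\<omega>\<in>space M. \<xi> \<omega> \<ge> z}"
  have AC: "0 \<le> A" "0 \<le> C"
    using lmn by (auto simp: A_def C_def)
  have "ennreal a \<le> (\<integral>\<^sup>+\<omega>. ennreal (exp (l * \<xi> \<omega>)) \<partial>M)"
    by (rule a)
  also have "\<dots> \<le> (\<integral>\<^sup>+\<omega>. ennreal A * ennreal (exp (m * \<xi> \<omega>)) + ennreal (exp (l * x)) * indicator ?E \<omega>
                    + ennreal C * ennreal (exp (n * \<xi> \<omega>)) \<partial>M)"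
  proof (rule nn_integral_mono)
    fix \<omega> assume "\<omega> \<in> space M"
    have "ennreal (exp (l * \<xi> \<omega>)) \<le> ennreal (A * exp (m * \<xi> \<omega>)
            + exp (l * x) * indicator {z..} (\<xi> \<omega>) + C * exp (n * \<xi> \<omega>))"
      unfolding A_def C_def by (intro ennreal_leI exp_le_three_regions lmn)
    also have "\<dots> = ennreal A * ennreal (exp (m * \<xi> \<omega>)) + ennreal (exp (l * x)) * indicator ?E \<omega>
                    + ennreal C * ennreal (exp (n * \<xi> \<omega>))"
      using AC \<open>\<omega> \<in> space M\<close> by (auto simp: indicator_def ennreal_plus ennreal_mult)
    finally show "ennreal (exp (l * \<xi> \<omega>)) \<le> \<dots>" .
  qed
  also have "\<dots> = ennreal A * (\<integral>\<^sup>+\<omega>. ennreal (exp (m * \<xi> \<omega>)) \<partial>M)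
                  + ennreal (exp (l * x)) * emeasure M ?E
                  + ennreal C * (\<integral>\<^sup>+\<omega>. ennreal (exp (n * \<xi> \<omega>)) \<partial>M)"
    by (simp add: nn_integral_add nn_integral_cmult nn_integral_cmult_indicator)
  also have "\<dots> \<le> ennreal A * ennreal b + ennreal (exp (l * x)) * ennreal (prob ?E)
                  + ennreal C * ennreal c"
    unfolding emeasure_eq_measure by (intro add_mono mult_left_mono b c order_refl) auto
  also have "\<dots> = ennreal (A * b + exp (l * x) * prob ?E + C * c)"
    using AC nonneg by (simp add: ennreal_plus ennreal_mult)
  finally have "a \<le> A * b + exp (l * x) * prob ?E + C * c"
    using AC nonneg by (subst (asm) ennreal_le_iff) auto
  then show ?thesis
    by (simp add: A_def C_def)
qed

theorem theorem4p1:
  fixes M :: "'a measure" and \<xi> :: "'a \<Rightarrow> real"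
    and \<Lambda> :: ereal and \<phi>1 \<phi>2 :: "real \<Rightarrow> real" and z :: real
  assumes "prob_space M"
    and "\<xi> \<in> borel_measurable M"
    and "0 < \<Lambda>"
    and "\<phi>1 \<in> Phi_class \<Lambda>" and "\<phi>2 \<in> Phi_class \<Lambda>"
    and "\<And>l. ereal \<bar>l\<bar> < \<Lambda> \<Longrightarrow> \<phi>1 l \<le> \<phi>2 l"
    and "\<And>l. ereal \<bar>l\<bar> < \<Lambda> \<Longrightarrow>
           ennreal (exp (\<phi>1 l)) \<le> (\<integral>\<^sup>+\<omega>. ennreal (exp (l * \<xi> \<omega>)) \<partial>M)"
    and "\<And>l. ereal \<bar>l\<bar> < \<Lambda> \<Longrightarrow>
           (\<integral>\<^sup>+\<omega>. ennreal (exp (l * \<xi> \<omega>)) \<partial>M) \<le> ennreal (exp (\<phi>2 l))"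
    and "z \<ge> 1"
  shows "ereal (tail_function M \<xi> z) \<ge> G_minus_bar \<Lambda> \<phi>1 \<phi>2 z"
proof -
  interpret prob_space M by fact
  note \<phi>2 = \<open>\<phi>2 \<in> Phi_class \<Lambda>\<close>
  have "G_minus \<Lambda> \<phi>1 \<phi>2 l z x \<le> tail_function M \<xi> z"
    if l: "0 < l" "ereal l < \<Lambda>" and z: "z \<in> {0<..<x_zero \<Lambda> \<phi>2 l}" and x: "x \<in> {x_zero \<Lambda> \<phi>2 l<..}"
    for l x
  proof -
    have I: "l \<in> sym_interval \<Lambda>" "0 \<in> sym_interval \<Lambda>"
      using l sym_interval_mono[of l \<Lambda> 0] by (auto simp: sym_interval_def)
    have zx: "deriv \<phi>2 0 < z" "z < deriv \<phi>2 l" "deriv \<phi>2 l < x"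
      using z x Phi_classD(6)[OF \<phi>2] x_zero_eq_deriv[OF \<phi>2 \<open>0 < \<Lambda>\<close> I(1)] by auto
    obtain m where m: "0 < m" "m < l" "m \<in> sym_interval \<Lambda>" "deriv \<phi>2 m = z"
      using Phi_class_deriv_IVT[OF \<phi>2 I(2,1) l(1) zx(1,2)] .
    obtain t where t: "l < t" "t \<in> sym_interval \<Lambda>" "x < deriv \<phi>2 t"
      using Phi_class_deriv_unbounded[OF \<phi>2 l] .
    obtain n where n: "l < n" "n \<in> sym_interval \<Lambda>" "deriv \<phi>2 n = x"
      using Phi_class_deriv_IVT[OF \<phi>2 I(1) t(2,1) zx(3) t(3)] .
    let ?P = "prob {\<omega>\<in>space M. \<xi> \<omega> \<ge> z}"
    let ?D = "exp (\<phi>1 l) - l / (l - m) * exp ((l - m) * z) * exp (\<phi>2 m)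
                - l / (n - l) * exp ((l - n) * x) * exp (\<phi>2 n)"
    have "?D \<le> exp (l * x) * ?P"
      using m n I(1) assms(7)[of l] assms(8)[of m] assms(8)[of n]
      by (intro tail_ge_of_exp_moments assms(2)) (auto simp: sym_interval_def)
    then have "exp (- l * x) * ?D \<le> exp (- l * x) * (exp (l * x) * ?P)"
      by (rule mult_left_mono) simp
    also have "\<dots> = ?P"
      by (simp add: exp_minus)
    finally have "exp (- l * x) * ?D \<le> ?P" .
    moreover have "G_minus \<Lambda> \<phi>1 \<phi>2 l z x = exp (- l * x) * ?D"
      using S_fun_at_slope[OF \<phi>2 \<open>0 < \<Lambda>\<close> m(3), of l] S_deriv_at_slope[OF \<phi>2 \<open>0 < \<Lambda>\<close> m(3), of l]
        S_fun_at_slope[OF \<phi>2 \<open>0 < \<Lambda>\<close> n(2), of l] S_deriv_at_slope[OF \<phi>2 \<open>0 < \<Lambda>\<close> n(2), of l]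
        m(2,4) n(1,3)
      by (simp add: G_minus_def exp_add)
    ultimately show ?thesis
      by (simp add: tail_function_def)
  qed
  then show ?thesis
    unfolding G_minus_bar_def by (intro Sup_least) auto
qed

end
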